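(* Let $\mathbb{F}$ be a field of characteristic $p>0$, $d\ge 2$, $n\ge1$, and let $T\in\mathsf T^d(n)$ satisfy $\mathrm{prank}(T) < n/(p-1)$. Then $\det(T)=0$. Equivalently, $\det(T)\neq 0$ implies $\mathrm{prank}(T)\ge n/(p-1)$.
   Context: $\mathsf{T}^d(n)$ denotes the set of functions $T:[n]^d \to \mathbb{F}$. The hyperdeterminant is $\det(T) = \sum_{\sigma_2,\dots,\sigma_d \in S_n} \mathrm{sgn}(\sigma_2\cdots\sigma_d)\prod_{i=1}^n T(i,\sigma_2(i),\dots,\sigma_d(i))$ (for any $d$). The partition rank $\mathrm{prank}(T)$ is the minimal $r$ such that $T$ is a sum of $r$ simple tensors ($0$ iff $T=0$), where a simple tensor has the form $T(i_1,\dots,i_d)=T_1(i_{a_1},\dots,i_{a_k})\,T_2(i_{b_1},\dots,i_{b_{d-k}})$ for some partition $\{a_1<\dots<a_k\}\cup\{b_1<\dots<b_{d-k}\}=[d]$ into two nonempty blocks and nonzero $T_1\in\mathsf T^k(n)$, $T_2\in\mathsf T^{d-k}(n)$ (the partition may differ between simple tensors). *)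

theory Defs
  imports Complex_Main "HOL-Combinatorics.Permutations"
begin

text \<open>
  The index set \<open>[n]\<close> is \<open>{..<n}\<close>, and coordinate positions are numbered from \<open>0\<close> as well. A multi-index
  in \<open>[n]\<^sup>d\<close> is a list, so that \<open>d\<close> and \<open>n\<close> can be ordinary variables.
\<close>

definition multi_indices :: "nat \<Rightarrow> nat \<Rightarrow> nat list set" where
  "multi_indices d n = {xs. length xs = d \<and> set xs \<subseteq> {..<n}}"

text \<open>
  A function \<open>[n]\<^sup>d \<Rightarrow> 'a\<close> is represented by its extension by zero to all lists, so equality of tensors
  is equality of functions.
\<close>

definition tensors :: "nat \<Rightarrow> nat \<Rightarrow> (nat list \<Rightarrow> 'a::zero) set" where
  "tensors d n = {T. \<forall>xs. xs \<notin> multi_indices d n \<longrightarrow> T xs = 0}"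

text \<open>
  The list \<open>\<sigma>s\<close> is \<open>[\<sigma>\<^sub>2, \<dots>, \<sigma>\<^sub>d]\<close>.
\<close>

definition hyperdet :: "nat \<Rightarrow> nat \<Rightarrow> (nat list \<Rightarrow> 'a::comm_ring_1) \<Rightarrow> 'a" where
  "hyperdet d n T =
     (\<Sum>\<sigma>s | length \<sigma>s = d - 1 \<and> set \<sigma>s \<subseteq> {\<sigma>. \<sigma> permutes {..<n}}.
        of_int (sign (foldr (\<circ>) \<sigma>s id)) * (\<Prod>i<n. T (i # map (\<lambda>\<sigma>. \<sigma> i) \<sigma>s)))"

text \<open>
  \<open>nths xs A\<close> lists the entries of \<open>xs\<close> at the positions in \<open>A\<close>, in increasing order of position,
  so for \<open>A = {a\<^sub>1 < \<dots> < a\<^sub>k}\<close> it is the argument of \<open>T\<^sub>1\<close> in the definition of a simple tensor.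
\<close>

definition simple_tensor :: "nat \<Rightarrow> nat \<Rightarrow> (nat list \<Rightarrow> 'a::field) \<Rightarrow> bool" where
  "simple_tensor d n T \<longleftrightarrow> T \<in> tensors d n \<and>
     (\<exists>A B T1 T2. A \<union> B = {..<d} \<and> A \<inter> B = {} \<and> A \<noteq> {} \<and> B \<noteq> {} \<and>
        T1 \<in> tensors (card A) n \<and> T1 \<noteq> (\<lambda>_. 0) \<and>
        T2 \<in> tensors (card B) n \<and> T2 \<noteq> (\<lambda>_. 0) \<and>
        (\<forall>xs\<in>multi_indices d n. T xs = T1 (nths xs A) * T2 (nths xs B)))"

definition sum_of_simple_tensors :: "nat \<Rightarrow> nat \<Rightarrow> (nat list \<Rightarrow> 'a::field) \<Rightarrow> nat \<Rightarrow> bool" where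
  "sum_of_simple_tensors d n T r \<longleftrightarrow>
     (\<exists>S. (\<forall>j<r. simple_tensor d n (S j)) \<and> T = (\<lambda>xs. \<Sum>j<r. S j xs))"

definition prank :: "nat \<Rightarrow> nat \<Rightarrow> (nat list \<Rightarrow> 'a::field) \<Rightarrow> nat" where
  "prank d n T = (LEAST r. sum_of_simple_tensors d n T r)"

lemma finite_multi_indices: "finite (multi_indices d n)"
  unfolding multi_indices_def
  using finite_lists_length_eq[of "{..<n}" d] by (simp add: conj_commute)

lemma simple_tensor_single:
  fixes c :: "'a::field"
  assumes d: "d \<ge> 2" and x: "x \<in> multi_indices d n" and c: "c \<noteq> 0"
  shows "simple_tensor d n (\<lambda>xs. if xs = x then c else 0)"
proof -
  obtain a y where xay: "x = a # y"
    using x d by (cases x) (auto simp: multi_indices_def)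
  define T1 :: "nat list \<Rightarrow> 'a" where "T1 = (\<lambda>xs. if xs = [a] then c else 0)"
  define T2 :: "nat list \<Rightarrow> 'a" where "T2 = (\<lambda>xs. if xs = y then 1 else 0)"
  have len: "length y = d - 1" "a < n" "set y \<subseteq> {..<n}"
    using x xay by (auto simp: multi_indices_def)
  have n1: "T1 \<noteq> (\<lambda>_. 0)"
    using c by (auto simp: T1_def fun_eq_iff)
  have n2: "T2 \<noteq> (\<lambda>_. 0)"
    by (auto simp: T2_def fun_eq_iff)
  have t1: "T1 \<in> tensors (card {0::nat}) n"
    using len by (auto simp: T1_def tensors_def multi_indices_def)
  have t2: "T2 \<in> tensors (card {1..<d}) n"
    using len by (auto simp: T2_def tensors_def multi_indices_def)
  have val: "(if xs = x then c else 0) = T1 (nths xs {0}) * T2 (nths xs {1..<d})"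
    if xs: "xs \<in> multi_indices d n" for xs
  proof -
    obtain b z where bz: "xs = b # z"
      using xs d by (cases xs) (auto simp: multi_indices_def)
    have lz: "length z = d - 1"
      using xs bz by (auto simp: multi_indices_def)
    have "{j. Suc j \<in> {1..<d}} = {..<d - 1}"
      by auto
    then have "nths xs {1..<d} = z"
      using lz by (simp add: bz nths_Cons)
    moreover have "nths xs {0} = [b]"
      by (simp add: bz nths_Cons)
    ultimately show ?thesis
      by (auto simp: T1_def T2_def bz xay)
  qed
  have "(\<lambda>xs. if xs = x then c else 0) \<in> tensors d n"
    using x by (auto simp: tensors_def)
  moreover have "{0} \<union> {1..<d} = {..<d}" "{0} \<inter> {1..<d} = {}" "{0::nat} \<noteq> {}" "{1..<d} \<noteq> {}"
    using d by auto
  ultimately show ?thesis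
    unfolding simple_tensor_def using t1 t2 n1 n2 val by blast
qed

text \<open>The minimum defining \<open>prank\<close> is over a nonempty set.\<close>

lemma ex_sum_of_simple_tensors:
  assumes d: "d \<ge> 2" and T: "T \<in> tensors d n"
  shows "\<exists>r. sum_of_simple_tensors d n T r"
proof -
  define X where "X = {x. T x \<noteq> 0}"
  have X: "X \<subseteq> multi_indices d n"
    using T by (auto simp: X_def tensors_def)
  have fin: "finite X"
    using X finite_multi_indices finite_subset by blast
  obtain h where h: "bij_betw h {..<card X} X"
    using ex_bij_betw_nat_finite[OF fin] by (auto simp: atLeast0LessThan)
  define S where "S = (\<lambda>j xs. if xs = h j then T (h j) else 0)"
  have "simple_tensor d n (S j)" if "j < card X" for j
  proof -
    have "h j \<in> X"
      using h that by (auto simp: bij_betw_def)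
    then show ?thesis
      unfolding S_def using X by (intro simple_tensor_single[OF d]) (auto simp: X_def)
  qed
  moreover have "T xs = (\<Sum>j<card X. S j xs)" for xs
  proof -
    have "(\<Sum>j<card X. S j xs) = (\<Sum>x\<in>X. if xs = x then T x else 0)"
      unfolding S_def by (rule sum.reindex_bij_betw[OF h])
    also have "\<dots> = T xs"
      using fin by (auto simp: X_def)
    finally show ?thesis ..
  qed
  ultimately show ?thesis
    unfolding sum_of_simple_tensors_def by blast
qed

lemma sum_of_simple_tensors_prank:
  assumes "d \<ge> 2" and "T \<in> tensors d n"
  shows "sum_of_simple_tensors d n T (prank d n T)"
  unfolding prank_def using ex_sum_of_simple_tensors[OF assms] by (rule LeastI_ex)

lemma prank_eq_0_iff:
  assumes "d \<ge> 2" and "T \<in> tensors d n"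
  shows "prank d n T = 0 \<longleftrightarrow> T = (\<lambda>_. 0)"
proof
  assume "prank d n T = 0"
  then show "T = (\<lambda>_. 0)"
    using sum_of_simple_tensors_prank[OF assms] by (simp add: sum_of_simple_tensors_def)
next
  assume "T = (\<lambda>_. 0)"
  then have "sum_of_simple_tensors d n T 0"
    by (simp add: sum_of_simple_tensors_def)
  then show "prank d n T = 0"
    unfolding prank_def by (simp add: Least_eq_0)
qed

end

theory Submission
  imports Defs "HOL-Computational_Algebra.Primes" "HOL-Combinatorics.Cycles"
begin

text \<open>
  Expand the hyperdeterminant of a sum of simple tensors \<open>S\<^sub>1, \<dots>, S\<^sub>r\<close> over all maps
  \<open>f : [n] \<rightarrow> [r]\<close> choosing a summand in every factor of the product. If \<open>r (p - 1) < n\<close>, some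
  fibre of \<open>f\<close> contains the support of a \<open>p\<close>-cycle \<open>\<tau>\<close>. Let \<open>B\<close> be the block of the corresponding
  simple tensor that does not contain the first coordinate. Replacing \<open>\<sigma>\<^sub>b\<close> by \<open>\<sigma>\<^sub>b \<circ> \<tau>\<close> for all
  \<open>b \<in> B\<close> only permutes the factors \<open>T\<^sub>2\<close> of the product, and \<open>\<tau>\<close> has sign \<open>1\<close> in \<open>\<F>\<close>. So the summand
  is invariant under a free action of the cyclic group of order \<open>p\<close>, and the sum vanishes modulo \<open>p\<close>.
\<close>

section \<open>Sums over free actions of a cyclic group of prime order\<close>

lemma funpow_eq_self:
  assumes "f x = x"
  shows "(f ^^ k) x = x"
  using assms by (induction k) auto

text \<open>Every orbit has exactly \<open>p\<close> elements and \<open>F\<close> is constant on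
  it, so it contributes a multiple of \<open>p\<close>. The induction removes one orbit at a
  time.\<close>

lemma sum_free_cyclic_eq_0:
  fixes F :: "'b \<Rightarrow> 'a::comm_ring_1"
  assumes p: "prime p" "of_nat p = (0::'a)"
    and X: "finite X"
    and g: "\<And>x. x \<in> X \<Longrightarrow> g x \<in> X" "\<And>x. x \<in> X \<Longrightarrow> (g ^^ p) x = x" "\<And>x. x \<in> X \<Longrightarrow> g x \<noteq> x"
    and F: "\<And>x. x \<in> X \<Longrightarrow> F (g x) = F x"
  shows "sum F X = 0"
  using X g F
proof (induction X rule: finite_psubset_induct)
  case (psubset X)
  note gX = psubset.prems
  show ?case
  proof (cases "X = {}")
    case False
    then obtain x where x: "x \<in> X"
      by auto
    define c where "c = (\<lambda>k. (g ^^ k) x)"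
    have cX: "c k \<in> X" for k
      using x gX(1) by (induction k) (auto simp: c_def)
    have Fc: "F (c k) = F x" for k
      using cX gX(4) by (induction k) (auto simp: c_def)
    have c_mod: "c (k mod p) = c k" for k
      unfolding c_def by (rule funpow_mod_eq) (use gX(2) x in auto)
    \<comment> \<open>As \<open>p\<close> is prime, \<open>k\<close> is invertible modulo
      \<open>p\<close>: a point fixed by \<open>g ^^ k\<close> and by \<open>g ^^ p\<close> would be
      fixed by \<open>g\<close> itself.\<close>
    have no_fix: "(g ^^ k) y \<noteq> y" if y: "y \<in> X" and k: "0 < k" "k < p" for y k
    proof
      assume fix_y: "(g ^^ k) y = y"
      have "gcd k p = 1"
        using k p(1) by (metis coprime_commute coprime_iff_gcd_eq_1 nat_dvd_not_less prime_imp_coprime)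
      then obtain u v where uv: "k * u = p * v + 1"
        using bezout_nat[of k p] k by auto
      have "y = (g ^^ (k * u)) y"
        using funpow_eq_self[of "g ^^ k" y u] fix_y by (simp add: funpow_mult mult.commute)
      also have "\<dots> = g ((g ^^ (p * v)) y)"
        by (simp add: uv)
      also have "(g ^^ (p * v)) y = y"
        using funpow_eq_self[of "g ^^ p" y v] gX(2)[OF y] by (simp add: funpow_mult mult.commute)
      finally show False
        using gX(3)[OF y] by simp
    qed
    have c_neq: "c i \<noteq> c j" if "i < j" "j < p" for i j
    proof -
      have "c j = (g ^^ (j - i)) (c i)"
        using that by (simp add: c_def flip: funpow_add[THEN fun_cong, unfolded comp_apply])
      then show ?thesis
        using no_fix[OF cX, of "j - i" i] that by force
    qed
    then have inj: "inj_on c {..<p}"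
      by (intro linorder_inj_onI) auto
    define Y where "Y = X - c ` {..<p}"
    have "p > 0"
      using p(1) prime_gt_0_nat by blast
    have "c 0 = x"
      by (simp add: c_def)
    then have "x \<notin> Y"
      using \<open>p > 0\<close> unfolding Y_def by blast
    then have "Y \<subset> X"
      using x by (auto simp: Y_def)
    moreover have "g y \<in> Y" if y: "y \<in> Y" for y
    proof -
      have yX: "y \<in> X"
        using y by (simp add: Y_def)
      moreover have "g y \<notin> c ` {..<p}"
      proof
        assume "g y \<in> c ` {..<p}"
        then obtain k where k: "g y = c k"
          by auto
        \<comment> \<open>On \<open>X\<close> the map \<open>g ^^ (p - 1)\<close> inverts
          \<open>g\<close>, so a point sent into the orbit already lies in it. Hence
          \<open>g\<close> preserves the complement \<open>Y\<close>.\<close>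
        have "y = (g ^^ (p - 1)) (g y)"
          using gX(2)[OF yX] \<open>p > 0\<close>
          by (metis Suc_diff_1 comp_apply funpow_Suc_right)
        also have "\<dots> = c ((p - 1 + k) mod p)"
          unfolding k c_mod by (simp add: c_def funpow_add)
        finally show False
          using y \<open>p > 0\<close> by (auto simp: Y_def)
      qed
      ultimately show ?thesis
        using gX(1) by (simp add: Y_def)
    qed
    ultimately have "sum F Y = 0"
      using gX by (intro psubset.IH) auto
    moreover have "sum F (c ` {..<p}) = 0"
      using p(2) by (simp add: sum.reindex[OF inj] Fc)
    moreover have "sum F X = sum F Y + sum F (c ` {..<p})"
      unfolding Y_def using cX psubset.hyps by (intro sum.subset_diff) auto
    ultimately show ?thesis
      by simp
  qed simp
qed

section \<open>Signs, sublists and cycles of prime length\<close>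

lemma sign_foldr_comp:
  assumes "\<And>\<sigma>. \<sigma> \<in> set \<sigma>s \<Longrightarrow> permutation \<sigma>"
  shows "sign (foldr (\<circ>) \<sigma>s id) = prod_list (map sign \<sigma>s)"
proof -
  have "permutation (foldr (\<circ>) \<sigma>s id) \<and> sign (foldr (\<circ>) \<sigma>s id) = prod_list (map sign \<sigma>s)"
    using assms by (induction \<sigma>s) (auto simp: sign_compose permutation_compose)
  then show ?thesis ..
qed

lemma nths_cong_nth:
  assumes "length xs = length ys" and "\<And>i. i < length xs \<Longrightarrow> i \<in> A \<Longrightarrow> xs ! i = ys ! i"
  shows "nths xs A = nths ys A"
  using assms
proof (induction xs ys arbitrary: A rule: list_induct2)
  case (Cons x xs y ys)
  have "nths xs {j. Suc j \<in> A} = nths ys {j. Suc j \<in> A}"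
    using Cons.prems[of "Suc _"] by (intro Cons.IH) auto
  then show ?case
    using Cons.prems[of 0] by (auto simp: nths_Cons)
qed simp

lemma ex_prime_cycle:
  assumes p: "prime p" and I: "finite I" "p \<le> card I"
  obtains \<tau> where "\<tau> permutes I" "\<tau> ^^ p = id" "\<tau> \<noteq> id"
proof -
  obtain C where C: "C \<subseteq> I" "card C = p" "finite C"
    using obtain_subset_with_card_n[OF I(2)] by metis
  obtain cs where cs: "set cs = C" "distinct cs"
    using finite_distinct_list[OF C(3)] by blast
  have len: "length cs = p"
    using cs C(2) distinct_card by fastforce
  define \<tau> where "\<tau> = cycle_of_list cs"
  have "\<tau> permutes I"
    unfolding \<tau>_def using cycle_permutes[of cs] C(1) cs(1) permutes_subset by blast
  moreover have "\<tau> ^^ p = id"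
    unfolding \<tau>_def using cycle_is_id_root[OF cs(2)] len by simp
  moreover have "\<tau> \<noteq> id"
  proof
    assume "\<tau> = id"
    \<comment> \<open>A cycle maps its list of points to the rotated list. Rotation moves the first
      entry, because \<open>cs\<close> is distinct and has length \<open>p\<close> \<ge> 2.\<close>
    then have "rotate1 cs = cs"
      using cyclic_rotation[OF cs(2), of 1] by (simp add: \<tau>_def)
    moreover obtain a b as where "cs = a # b # as"
      using prime_ge_2_nat[OF p] len by (cases cs rule: remdups_adj.cases) auto
    ultimately show False
      using cs(2) by simp
  qed
  ultimately show ?thesis ..
qed

text \<open>For odd \<open>p\<close> the sign is already 1 as an integer, since its
  \<open>p\<close>-th power is 1. For \<open>p = 2\<close> it may be -1, but then -1 = 1 in the
  ring.\<close>

lemma of_int_sign_eq_1_of_funpow_eq_id: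
  assumes p: "prime p" "of_nat p = (0::'a::comm_ring_1)"
    and \<tau>: "permutation \<tau>" "\<tau> ^^ p = id"
  shows "of_int (sign \<tau>) = (1::'a)"
proof (cases "p = 2")
  case True
  then have "(1::'a) + 1 = 0"
    using p(2) by simp
  then have "- (1::'a) = 1"
    by (simp add: minus_equation_iff eq_neg_iff_add_eq_0)
  then show ?thesis
    by (cases rule: sign_cases[of \<tau>]) auto
next
  case False
  have "permutation (\<tau> ^^ k) \<and> sign (\<tau> ^^ k) = sign \<tau> ^ k" for k
    using \<tau>(1) by (induction k) (auto simp: sign_compose permutation_compose)
  then have "sign \<tau> ^ p = 1"
    using \<tau>(2) by (metis sign_id)
  moreover have "odd p"
    using p(1) False primes_dvd_imp_eq two_is_prime_nat by blast
  ultimately have "sign \<tau> = 1"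
    by (cases rule: sign_cases[of \<tau>]) auto
  then show ?thesis
    by simp
qed

section \<open>Twisting the permutations of one block of coordinates\<close>

text \<open>
  Entry \<open>l\<close> of a list of permutations belongs to coordinate \<open>Suc l\<close>: coordinate \<open>0\<close> carries none.
\<close>

definition compose_at :: "nat set \<Rightarrow> ('b \<Rightarrow> 'b) \<Rightarrow> ('b \<Rightarrow> 'c) list \<Rightarrow> ('b \<Rightarrow> 'c) list" where
  "compose_at B \<tau> \<sigma>s = map (\<lambda>l. if Suc l \<in> B then \<sigma>s ! l \<circ> \<tau> else \<sigma>s ! l) [0..<length \<sigma>s]"

lemma length_compose_at [simp]: "length (compose_at B \<tau> \<sigma>s) = length \<sigma>s"
  by (simp add: compose_at_def)

lemma nth_compose_at:
  "l < length \<sigma>s \<Longrightarrow> compose_at B \<tau> \<sigma>s ! l = (if Suc l \<in> B then \<sigma>s ! l \<circ> \<tau> else \<sigma>s ! l)"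
  by (simp add: compose_at_def)

text \<open>This transfers the relation \<open>\<tau> ^^ p = id\<close> to the map
  \<open>compose_at B \<tau>\<close>.\<close>

lemma funpow_compose_at: "(compose_at B \<tau> ^^ k) \<sigma>s = compose_at B (\<tau> ^^ k) \<sigma>s"
proof (induction k)
  case 0
  show ?case
    by (auto intro!: nth_equalityI simp: nth_compose_at)
next
  case (Suc k)
  then show ?case
    by (auto intro!: nth_equalityI simp: nth_compose_at funpow_swap1)
qed

lemma set_compose_at:
  assumes "set \<sigma>s \<subseteq> {\<sigma>. \<sigma> permutes N}" and "\<tau> permutes N"
  shows "set (compose_at B \<tau> \<sigma>s) \<subseteq> {\<sigma>. \<sigma> permutes N}"
  using assms permutes_compose[OF assms(2)] by (force simp: compose_at_def subset_iff)

text \<open>Each twisted entry changes the sign by the factor \<open>sign \<tau>\<close>. The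
  integer signs may differ, as for a transposition in characteristic 2, so only their images in the
  ring are compared.\<close>

lemma sign_compose_at:
  assumes \<sigma>s: "\<And>\<sigma>. \<sigma> \<in> set \<sigma>s \<Longrightarrow> permutation \<sigma>"
    and \<tau>: "permutation \<tau>" "of_int (sign \<tau>) = (1::'a::comm_ring_1)"
  shows "of_int (sign (foldr (\<circ>) (compose_at B \<tau> \<sigma>s) id)) = (of_int (sign (foldr (\<circ>) \<sigma>s id)) :: 'a)"
proof -
  have perm: "permutation \<sigma>" if "\<sigma> \<in> set (compose_at B \<tau> \<sigma>s)" for \<sigma>
    using that \<sigma>s \<tau>(1) by (auto simp: compose_at_def permutation_compose)
  have "of_int (prod_list (map sign (compose_at B \<tau> \<sigma>s))) =
      (\<Prod>l<length \<sigma>s. of_int (sign (compose_at B \<tau> \<sigma>s ! l)) :: 'a)"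
    by (simp add: prod.list_conv_set_nth atLeast0LessThan)
  also have "\<dots> = (\<Prod>l<length \<sigma>s. of_int (sign (\<sigma>s ! l)))"
    using \<sigma>s \<tau> by (intro prod.cong) (auto simp: nth_compose_at sign_compose)
  also have "\<dots> = of_int (prod_list (map sign \<sigma>s))"
    by (simp add: prod.list_conv_set_nth atLeast0LessThan)
  finally show ?thesis
    using \<sigma>s perm by (simp add: sign_foldr_comp)
qed

section \<open>Vanishing of the terms with a large fibre\<close>

lemma Cons_map_in_multi_indices:
  assumes "i < n" and "length \<sigma>s = d - 1" and "set \<sigma>s \<subseteq> {\<sigma>. \<sigma> permutes {..<n}}" and "d > 0"
  shows "i # map (\<lambda>\<sigma>. \<sigma> i) \<sigma>s \<in> multi_indices d n"
proof -
  have "\<sigma> i < n" if "\<sigma> \<in> set \<sigma>s" for \<sigma>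
    using that assms(1,3) permutes_in_image[of \<sigma> "{..<n}" i] by auto
  then show ?thesis
    using assms(1,2,4) by (auto simp: multi_indices_def)
qed

text \<open>The two blocks play symmetric roles, so the factors can be swapped until
  \<open>B\<close> avoids coordinate 0, the one that carries no permutation to twist.\<close>

lemma simple_tensorE:
  assumes "simple_tensor d n S" and "d > 0"
  obtains B T1 T2 where "B \<subseteq> {1..<d}" "B \<noteq> {}"
    "\<And>xs. xs \<in> multi_indices d n \<Longrightarrow> S xs = T1 (nths xs ({..<d} - B)) * T2 (nths xs B)"
proof -
  obtain A B T1 T2 where AB: "A \<union> B = {..<d}" "A \<inter> B = {}" "A \<noteq> {}" "B \<noteq> {}"
    and S: "\<And>xs. xs \<in> multi_indices d n \<Longrightarrow> S xs = T1 (nths xs A) * T2 (nths xs B)"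
    using assms(1) unfolding simple_tensor_def by blast
  have A: "A = {..<d} - B" and B: "B = {..<d} - A"
    using AB by auto
  show thesis
  proof (cases "0 \<in> A")
    case True
    then have "0 \<notin> B"
      using AB(2) by blast
    then have "B \<subseteq> {..<d} - {0}"
      using AB(1) by blast
    also have "\<dots> = {1..<d}"
      by auto
    finally show thesis
      using AB(4) S unfolding A by (rule that)
  next
    case False
    then have "A \<subseteq> {..<d} - {0}"
      using AB(1) by blast
    also have "\<dots> = {1..<d}"
      by auto
    finally show thesis
      using AB(3) S[unfolded B mult.commute[of "T1 _"]] by (rule that)
  qed
qed

text \<open>This treats one map \<open>f\<close> of the expansion: \<open>R i\<close> is the summand
  chosen in factor \<open>i\<close>, and \<open>I\<close> lies in a fibre of
  \<open>f\<close>.\<close>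

lemma mixed_hyperdet_eq_0:
  fixes R :: "nat \<Rightarrow> nat list \<Rightarrow> 'a::field"
  assumes p: "prime p" "of_nat p = (0::'a)" and d: "d > 0"
    and S: "simple_tensor d n S"
    and I: "I \<subseteq> {..<n}" "p \<le> card I" "\<And>i. i \<in> I \<Longrightarrow> R i = S"
  shows "(\<Sum>\<sigma>s | length \<sigma>s = d - 1 \<and> set \<sigma>s \<subseteq> {\<sigma>. \<sigma> permutes {..<n}}.
            of_int (sign (foldr (\<circ>) \<sigma>s id)) * (\<Prod>i<n. R i (i # map (\<lambda>\<sigma>. \<sigma> i) \<sigma>s))) = 0"
    (is "sum ?F ?X = 0")
proof -
  have finI: "finite I"
    using I(1) finite_subset by blast
  obtain \<tau> where \<tau>: "\<tau> permutes I" "\<tau> ^^ p = id" "\<tau> \<noteq> id"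
    using ex_prime_cycle[OF p(1) finI I(2)] .
  have \<tau>n: "\<tau> permutes {..<n}"
    using \<tau>(1) I(1) by (rule permutes_subset)
  have perm: "permutation \<sigma>" if "\<sigma> permutes {..<n}" for \<sigma>
    using that permutation_permutes by blast
  obtain B T1 T2 where B: "B \<subseteq> {1..<d}" "B \<noteq> {}"
    and S_eq: "\<And>xs. xs \<in> multi_indices d n \<Longrightarrow> S xs = T1 (nths xs ({..<d} - B)) * T2 (nths xs B)"
    using simple_tensorE[OF S d] by metis
  define row where "row = (\<lambda>\<sigma>s i. i # map (\<lambda>\<sigma>. \<sigma> i) \<sigma>s :: nat list)"
  have prod_inv: "(\<Prod>i<n. R i (row (compose_at B \<tau> \<sigma>s) i)) = (\<Prod>i<n. R i (row \<sigma>s i))"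
    if "\<sigma>s \<in> ?X" for \<sigma>s
  proof -
    have len: "length \<sigma>s = d - 1" and \<sigma>s: "set \<sigma>s \<subseteq> {\<sigma>. \<sigma> permutes {..<n}}"
      using that by auto
    have out: "row (compose_at B \<tau> \<sigma>s) i = row \<sigma>s i" if "i \<notin> I" for i
    proof -
      have "\<tau> i = i"
        using \<tau>(1) that by (rule permutes_not_in)
      then show ?thesis
        by (auto simp: row_def nth_compose_at intro!: nth_equalityI)
    qed
    have block1: "nths (row (compose_at B \<tau> \<sigma>s) i) ({..<d} - B) = nths (row \<sigma>s i) ({..<d} - B)" for i
      by (rule nths_cong_nth) (auto simp: row_def nth_Cons nth_compose_at split: nat.splits)
    \<comment> \<open>At position \<open>Suc l\<close> in \<open>B\<close> both rows have the entry
      \<open>(\<sigma>s ! l) (\<tau> i)\<close>. Position 0, where they hold \<open>i\<close> and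
      \<open>\<tau> i\<close>, is excluded by \<open>B \<subseteq> {1..<d}\<close>.\<close>
    have block2: "nths (row (compose_at B \<tau> \<sigma>s) i) B = nths (row \<sigma>s (\<tau> i)) B" for i
      using B(1) by (intro nths_cong_nth) (auto simp: row_def nth_Cons nth_compose_at split: nat.splits)
    have \<sigma>s': "set (compose_at B \<tau> \<sigma>s) \<subseteq> {\<sigma>. \<sigma> permutes {..<n}}"
      using \<sigma>s \<tau>n by (rule set_compose_at)
    have row_in: "row \<sigma>s i \<in> multi_indices d n" "row (compose_at B \<tau> \<sigma>s) i \<in> multi_indices d n"
      if "i \<in> I" for i
      unfolding row_def using that I(1) len d
      by (auto intro!: Cons_map_in_multi_indices[OF _ _ \<sigma>s] Cons_map_in_multi_indices[OF _ _ \<sigma>s'])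
    have "(\<Prod>i\<in>I. R i (row (compose_at B \<tau> \<sigma>s) i)) =
        (\<Prod>i\<in>I. T1 (nths (row \<sigma>s i) ({..<d} - B)) * T2 (nths (row \<sigma>s (\<tau> i)) B))"
      by (intro prod.cong) (simp_all add: I(3) S_eq row_in block1 block2)
    also have "\<dots> = (\<Prod>i\<in>I. T1 (nths (row \<sigma>s i) ({..<d} - B))) * (\<Prod>i\<in>I. T2 (nths (row \<sigma>s (\<tau> i)) B))"
      by (rule prod.distrib)
    also have "(\<Prod>i\<in>I. T2 (nths (row \<sigma>s (\<tau> i)) B)) = (\<Prod>i\<in>I. T2 (nths (row \<sigma>s i) B))"
      by (rule prod.reindex_bij_betw[OF permutes_imp_bij[OF \<tau>(1)]])
    also have "(\<Prod>i\<in>I. T1 (nths (row \<sigma>s i) ({..<d} - B))) * \<dots> = (\<Prod>i\<in>I. R i (row \<sigma>s i))"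
      by (simp add: I(3) S_eq row_in prod.distrib)
    finally have "(\<Prod>i\<in>I. R i (row (compose_at B \<tau> \<sigma>s) i)) = (\<Prod>i\<in>I. R i (row \<sigma>s i))" .
    \<comment> \<open>Off \<open>I\<close> the cycle fixes \<open>i\<close>, so these rows do not
      change, whatever tensors \<open>R i\<close> are chosen there.\<close>
    moreover have "(\<Prod>i\<in>{..<n} - I. R i (row (compose_at B \<tau> \<sigma>s) i)) = (\<Prod>i\<in>{..<n} - I. R i (row \<sigma>s i))"
      by (intro prod.cong) (simp_all add: out)
    ultimately show ?thesis
      by (simp add: prod.subset_diff[OF I(1)])
  qed
  show ?thesis
  proof (rule sum_free_cyclic_eq_0[OF p, where g = "compose_at B \<tau>"])
    show "finite ?X"
      using finite_lists_length_eq[OF finite_permutations[of "{..<n}"], of "d - 1"]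
      by (simp add: conj_commute)
    fix \<sigma>s assume \<sigma>s: "\<sigma>s \<in> ?X"
    then show "compose_at B \<tau> \<sigma>s \<in> ?X"
      using set_compose_at[OF _ \<tau>n] by auto
    show "(compose_at B \<tau> ^^ p) \<sigma>s = \<sigma>s"
      by (auto simp: funpow_compose_at \<tau>(2) nth_compose_at intro!: nth_equalityI)
    show "compose_at B \<tau> \<sigma>s \<noteq> \<sigma>s"
    proof
      assume eq: "compose_at B \<tau> \<sigma>s = \<sigma>s"
      \<comment> \<open>Freeness: a nonempty \<open>B\<close> provides a coordinate that is really
        twisted, and injectivity of its permutation cancels it from
        \<open>\<sigma>s ! l \<circ> \<tau> = \<sigma>s ! l\<close>.\<close>
      obtain b where "b \<in> B"
        using B(2) by blast
      then obtain l where l: "Suc l \<in> B" "l < length \<sigma>s"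
        using B(1) \<sigma>s by (cases b) auto
      then have "\<sigma>s ! l \<circ> \<tau> = \<sigma>s ! l"
        using nth_compose_at[OF l(2), of B \<tau>] eq by simp
      moreover have "\<sigma>s ! l permutes {..<n}"
        using \<sigma>s l(2) by (auto simp: subset_iff)
      ultimately have "\<tau> = id"
        using inj_onD[OF permutes_inj] by (fastforce simp: fun_eq_iff)
      with \<tau>(3) show False ..
    qed
    have "of_int (sign (foldr (\<circ>) (compose_at B \<tau> \<sigma>s) id)) = (of_int (sign (foldr (\<circ>) \<sigma>s id)) :: 'a)"
      using \<sigma>s perm
      by (intro sign_compose_at of_int_sign_eq_1_of_funpow_eq_id[OF p] \<tau>(2) perm[OF \<tau>n]) auto
    then show "?F (compose_at B \<tau> \<sigma>s) = ?F \<sigma>s"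
      using prod_inv[OF \<sigma>s] unfolding row_def by simp
  qed
qed

section \<open>Expansion over choice maps and the pigeonhole principle\<close>

lemma hyperdet_sum:
  assumes "finite J"
  shows "hyperdet d n (\<lambda>xs. \<Sum>j\<in>J. S j xs) =
     (\<Sum>f\<in>{..<n} \<rightarrow>\<^sub>E J. \<Sum>\<sigma>s | length \<sigma>s = d - 1 \<and> set \<sigma>s \<subseteq> {\<sigma>. \<sigma> permutes {..<n}}.
        of_int (sign (foldr (\<circ>) \<sigma>s id)) * (\<Prod>i<n. S (f i) (i # map (\<lambda>\<sigma>. \<sigma> i) \<sigma>s)))"
  unfolding hyperdet_def prod_sum_PiE[OF finite_lessThan assms] sum_distrib_left
  by (rule sum.swap)

lemma hyperdet_eq_0_of_sum_of_simple_tensors: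
  fixes T :: "nat list \<Rightarrow> 'a::field"
  assumes p: "prime p" "of_nat p = (0::'a)" and d: "d > 0"
    and T: "sum_of_simple_tensors d n T r" and r: "r * (p - 1) < n"
  shows "hyperdet d n T = 0"
proof -
  obtain S where S: "\<And>j. j < r \<Longrightarrow> simple_tensor d n (S j)" and T_eq: "T = (\<lambda>xs. \<Sum>j<r. S j xs)"
    using T unfolding sum_of_simple_tensors_def by blast
  show ?thesis
    unfolding T_eq hyperdet_sum[OF finite_lessThan]
  proof (rule sum.neutral, intro ballI)
    fix f assume f: "f \<in> {..<n} \<rightarrow>\<^sub>E {..<r}"
    \<comment> \<open>The bound on \<open>r\<close> forces \<open>n > 0\<close>, and a nonempty set
      has no map into the empty set.\<close>
    have "r \<noteq> 0"
      using f r by (auto simp: PiE_iff)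
    then obtain j where j: "j < r" "n \<le> card (f -` {j} \<inter> {..<n}) * r"
      using pigeonhole_card[of f "{..<n}" "{..<r}"] f by auto
    have "p \<le> card (f -` {j} \<inter> {..<n})"
    \<comment> \<open>If the largest fibre had at most \<open>p - 1\<close> elements, then
      \<open>n \<le> (p - 1) * r\<close>, against the bound on \<open>r\<close>.\<close>
    proof (rule ccontr)
      assume "\<not> ?thesis"
      then have "card (f -` {j} \<inter> {..<n}) * r \<le> (p - 1) * r"
        by (intro mult_le_mono1) simp
      with j(2) r show False
        unfolding mult.commute[of _ r] by (meson leD le_trans)
    qed
    then show "(\<Sum>\<sigma>s | length \<sigma>s = d - 1 \<and> set \<sigma>s \<subseteq> {\<sigma>. \<sigma> permutes {..<n}}.
        of_int (sign (foldr (\<circ>) \<sigma>s id)) * (\<Prod>i<n. S (f i) (i # map (\<lambda>\<sigma>. \<sigma> i) \<sigma>s))) = 0"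
      by (intro mixed_hyperdet_eq_0[OF p d S[OF j(1)], of "f -` {j} \<inter> {..<n}"]) auto
  qed
qed

theorem theorem4p5:
  fixes T :: "nat list \<Rightarrow> 'a::field" and p d n :: nat
  assumes "CHAR('a) = p" and "p > 0" and "d \<ge> 2" and "n \<ge> 1" and "T \<in> tensors d n"
  shows "(real (prank d n T) < real n / (real p - 1) \<longrightarrow> hyperdet d n T = 0) \<and>
         (hyperdet d n T \<noteq> 0 \<longrightarrow> real (prank d n T) \<ge> real n / (real p - 1))"
proof -
  have p: "prime p"
    using assms(1,2) prime_CHAR_semidom[where ?'a = 'a] by simp
  have p0: "of_nat p = (0::'a)"
    using assms(1) of_nat_CHAR by blast
  have "hyperdet d n T = 0" if less: "real (prank d n T) < real n / (real p - 1)"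
  proof (rule hyperdet_eq_0_of_sum_of_simple_tensors[OF p p0])
    \<comment> \<open>Since \<open>p > 1\<close>, the denominator is positive and the subtraction in
      \<open>nat\<close> agrees with the real one.\<close>
    have "real (prank d n T * (p - 1)) < real n"
      using less prime_gt_1_nat[OF p] by (simp add: field_simps of_nat_diff)
    then show "prank d n T * (p - 1) < n"
      by (simp only: of_nat_less_iff)
  qed (use assms sum_of_simple_tensors_prank in auto)
  then show ?thesis
    by force
qed

end
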